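(* Let $(c_k)_{k\in\mathbb N}$ be pairwise coprime odd integers greater than $1$, let $$\mathcal B_1^\infty=\{2^kc_k:k\in\mathbb N\}\cup\{2^{k-1}c_k^2:k\in\mathbb N\},$$ and let $(X_\eta,\sigma)$ be the $\mathcal B_1^\infty$-free subshift. Then the group $\operatorname{Aut}_\sigma(X_\eta)/\langle\sigma\rangle$ contains (a subgroup isomorphic to) the infinite direct sum of finite cyclic groups $$\mathbb Z/c_1\mathbb Z\oplus\mathbb Z/c_2\mathbb Z\oplus\dots\oplus\mathbb Z/c_\ell\mathbb Z\oplus\cdots .$$
   Context: $\mathbb N=\{1,2,\dots\}$. For $\mathcal B\subseteq\{2,3,\dots\}$, $\eta\in\{0,1\}^{\mathbb Z}$ is the characteristic function of $\mathbb Z\setminus\bigcup_{b\in\mathcal B}b\mathbb Z$, $\sigma$ is the left shift, and the $\mathcal B$-free subshift $X_\eta$ is the orbit closure of $\eta$ in $\{0,1\}^{\mathbb Z}$. $\operatorname{Aut}_\sigma(X_\eta)$ is the group of homeomorphisms of $X_\eta$ commuting with $\sigma$, and $\langle\sigma\rangle$ is its (normal) subgroup of powers of the shift. *)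

theory Defs
  imports
    "HOL-Analysis.Function_Topology"
    "HOL-Algebra.Bij"
    "HOL-Algebra.Coset"
    "HOL-Algebra.Generated_Groups"
    "HOL-Algebra.Product_Groups"
begin

text \<open>
  The full shift \<open>{0,1}\<^sup>\<int>\<close> is the type \<^typ>\<open>int \<Rightarrow> bool\<close>, with \<^term>\<open>True\<close> for the symbol 1.
  Its type-class topology is the product of the discrete topologies on \<^typ>\<open>bool\<close>.
\<close>

definition shift_by :: "int \<Rightarrow> (int \<Rightarrow> bool) \<Rightarrow> (int \<Rightarrow> bool)"
  where "shift_by k x = (\<lambda>n. x (n + k))"

abbreviation left_shift :: "(int \<Rightarrow> bool) \<Rightarrow> (int \<Rightarrow> bool)"
  where "left_shift \<equiv> shift_by 1"

lemma shift_by_0 [simp]: "shift_by 0 x = x"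
  by (simp add: shift_by_def)

lemma shift_by_add: "shift_by (i + j) x = shift_by i (shift_by j x)"
  by (simp add: shift_by_def algebra_simps)

definition orbit_closure :: "(int \<Rightarrow> bool) \<Rightarrow> (int \<Rightarrow> bool) set"
  where "orbit_closure x = closure (range (\<lambda>k. shift_by k x))"

definition eta :: "nat set \<Rightarrow> int \<Rightarrow> bool"
  where "eta B = (\<lambda>n. n \<in> UNIV - (\<Union>b\<in>B. range (\<lambda>m. int b * m)))"

definition free_subshift :: "nat set \<Rightarrow> (int \<Rightarrow> bool) set"
  where "free_subshift B = orbit_closure (eta B)"

text \<open>
  As in \<^const>\<open>BijGroup\<close>, self-maps of \<open>X\<close> are represented by functions that are
  \<^const>\<open>undefined\<close> outside \<open>X\<close>, and the product is composition.
\<close>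

definition shift_auts :: "(int \<Rightarrow> bool) set \<Rightarrow> ((int \<Rightarrow> bool) \<Rightarrow> (int \<Rightarrow> bool)) set"
  where "shift_auts X =
    {f \<in> Bij X. (\<exists>g. homeomorphism X X f g) \<and> (\<forall>x\<in>X. f (left_shift x) = left_shift (f x))}"

definition Aut_shift :: "(int \<Rightarrow> bool) set \<Rightarrow> ((int \<Rightarrow> bool) \<Rightarrow> (int \<Rightarrow> bool)) monoid"
  where "Aut_shift X = (BijGroup X)\<lparr>carrier := shift_auts X\<rparr>"

definition shift_powers :: "(int \<Rightarrow> bool) set \<Rightarrow> ((int \<Rightarrow> bool) \<Rightarrow> (int \<Rightarrow> bool)) set"
  where "shift_powers X = generate (Aut_shift X) {restrict left_shift X}"

definition B1_infty :: "(nat \<Rightarrow> nat) \<Rightarrow> nat set"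
  where "B1_infty c = {2 ^ k * c k |k. k \<ge> 1} \<union> {2 ^ (k - 1) * (c k)\<^sup>2 |k. k \<ge> 1}"

text \<open>
  The group and its quotient by \<^const>\<open>shift_powers\<close> are well defined for the set
  \<^term>\<open>free_subshift B\<close>, as the lemmas below show.
\<close>

lemma continuous_on_shift_by: "continuous_on S (shift_by k)"
  unfolding shift_by_def
  by (intro continuous_on_coordinatewise_then_product continuous_on_product_coordinates
        continuous_on_subset[OF continuous_on_product_coordinates]) auto

lemma homeomorphism_shift_by:
  assumes "\<And>i. shift_by i ` X \<subseteq> X"
  shows "homeomorphism X X (shift_by k) (shift_by (- k))"
  using assms by (intro homeomorphismI) (auto simp: continuous_on_shift_by simp flip: shift_by_add)

lemma shift_by_orbit_closure: "shift_by i ` orbit_closure x \<subseteq> orbit_closure x"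
  unfolding orbit_closure_def
proof (rule image_closure_subset[OF continuous_on_shift_by closed_closure])
  show "shift_by i ` range (\<lambda>k. shift_by k x) \<subseteq> closure (range (\<lambda>k. shift_by k x))"
    by (rule subset_trans[OF _ closure_subset]) (auto simp flip: shift_by_add)
qed

locale shift_invariant =
  fixes X :: "(int \<Rightarrow> bool) set"
  assumes invariant: "shift_by i ` X \<subseteq> X"
begin

lemma shift_in: "x \<in> X \<Longrightarrow> shift_by i x \<in> X"
  using invariant by blast

lemma shift_auts_inv:
  assumes f: "f \<in> shift_auts X"
  shows "restrict (inv_into X f) X \<in> shift_auts X"
proof -
  obtain g where g: "homeomorphism X X f g"
    using f by (auto simp: shift_auts_def)
  have bij: "f \<in> Bij X" and com: "\<And>x. x \<in> X \<Longrightarrow> f (left_shift x) = left_shift (f x)"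
    using f by (auto simp: shift_auts_def)
  have inj: "inj_on f X" and im: "f ` X = X"
    using bij by (auto simp: Bij_def bij_betw_def)
  have eq: "restrict (inv_into X f) X y = g y" if "y \<in> X" for y
    using that g inj by (auto simp: homeomorphism_def intro!: inv_into_f_eq)
  have "homeomorphism X X (restrict (inv_into X f) X) f"
    by (rule homeomorphism_cong[OF homeomorphism_symD[OF g]]) (use eq in auto)
  moreover have "restrict (inv_into X f) X (left_shift y) = left_shift (restrict (inv_into X f) X y)"
    if y: "y \<in> X" for y
  proof -
    have *: "g y \<in> X" "f (g y) = y"
      using g y by (auto simp: homeomorphism_def)
    have "g (left_shift y) = g (f (left_shift (g y)))"
      using com[OF *(1)] *(2) by simp
    also have "\<dots> = left_shift (g y)"
      using g * shift_in by (auto simp: homeomorphism_def)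
    finally show ?thesis
      using eq y shift_in by metis
  qed
  ultimately show ?thesis
    using bij restrict_inv_into_Bij unfolding shift_auts_def by blast
qed

lemma subgroup_shift_auts: "subgroup (shift_auts X) (BijGroup X)"
proof
  show "shift_auts X \<subseteq> carrier (BijGroup X)"
    by (auto simp: shift_auts_def BijGroup_def)
next
  fix f g assume fg: "f \<in> shift_auts X" "g \<in> shift_auts X"
  then have bij: "f \<in> Bij X" "g \<in> Bij X"
    by (auto simp: shift_auts_def)
  obtain f' g' where "homeomorphism X X f f'" "homeomorphism X X g g'"
    using fg by (auto simp: shift_auts_def)
  then have "homeomorphism X X (f \<circ> g) (g' \<circ> f')"
    by (rule homeomorphism_compose[rotated])
  then have "homeomorphism X X (compose X f g) (g' \<circ> f')"
    by (rule homeomorphism_cong) (auto simp: compose_def)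
  moreover have "compose X f g (left_shift x) = left_shift (compose X f g x)" if "x \<in> X" for x
    using that fg shift_in[OF that] bij
    by (auto simp: compose_def shift_auts_def Bij_def bij_betw_def)
  ultimately show "f \<otimes>\<^bsub>BijGroup X\<^esub> g \<in> shift_auts X"
    using bij by (auto simp: BijGroup_def shift_auts_def compose_Bij)
next
  have "homeomorphism X X (\<lambda>x\<in>X. x) id"
    by (rule homeomorphism_cong[OF homeomorphism_ident]) auto
  then show "\<one>\<^bsub>BijGroup X\<^esub> \<in> shift_auts X"
    using shift_in by (auto simp: BijGroup_def shift_auts_def id_Bij)
next
  fix f assume "f \<in> shift_auts X"
  then show "inv\<^bsub>BijGroup X\<^esub> f \<in> shift_auts X"
    using shift_auts_inv by (auto simp: inv_BijGroup shift_auts_def)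
qed

lemma group_Aut_shift: "group (Aut_shift X)"
  unfolding Aut_shift_def
  by (rule subgroup.subgroup_is_group[OF subgroup_shift_auts group_BijGroup])

lemma restrict_shift_in: "restrict left_shift X \<in> carrier (Aut_shift X)"
proof -
  have h: "homeomorphism X X left_shift (shift_by (- 1))"
    by (rule homeomorphism_shift_by[OF invariant])
  have "homeomorphism X X (restrict left_shift X) (shift_by (- 1))"
    by (rule homeomorphism_cong[OF h]) auto
  moreover from this have "restrict left_shift X \<in> Bij X"
    unfolding Bij_def homeomorphism_def
    by (auto intro!: bij_betw_byWitness[where f' = "shift_by (- 1)"] simp flip: shift_by_add)
  ultimately show ?thesis
    using shift_in by (auto simp: Aut_shift_def shift_auts_def)
qed

lemma Aut_shift_commute:
  assumes "f \<in> carrier (Aut_shift X)"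
  shows "f \<otimes>\<^bsub>Aut_shift X\<^esub> restrict left_shift X = restrict left_shift X \<otimes>\<^bsub>Aut_shift X\<^esub> f"
proof -
  have "f \<in> Bij X" "restrict left_shift X \<in> Bij X"
    "\<And>x. x \<in> X \<Longrightarrow> f (left_shift x) = left_shift (f x)"
    using assms restrict_shift_in by (auto simp: Aut_shift_def shift_auts_def)
  then show ?thesis
    by (auto simp: Aut_shift_def BijGroup_def compose_def Bij_def bij_betw_def fun_eq_iff)
qed

lemma normal_shift_powers: "shift_powers X \<lhd> Aut_shift X"
proof -
  interpret G: group "Aut_shift X"
    by (rule group_Aut_shift)
  let ?s = "restrict left_shift X"
  show ?thesis
    unfolding shift_powers_def
  proof (rule G.normal_generateI)
    show "{?s} \<subseteq> carrier (Aut_shift X)"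
      using restrict_shift_in by simp
    fix h f assume h: "h \<in> {?s}" and f: "f \<in> carrier (Aut_shift X)"
    then have "f \<otimes>\<^bsub>Aut_shift X\<^esub> h \<otimes>\<^bsub>Aut_shift X\<^esub> inv\<^bsub>Aut_shift X\<^esub> f = ?s"
      using Aut_shift_commute[OF f] restrict_shift_in
      by (simp add: G.m_assoc)
    then show "f \<otimes>\<^bsub>Aut_shift X\<^esub> h \<otimes>\<^bsub>Aut_shift X\<^esub> inv\<^bsub>Aut_shift X\<^esub> f \<in> {?s}"
      by simp
  qed
qed

end

lemma shift_invariant_free_subshift: "shift_invariant (free_subshift B)"
  by standard (simp add: free_subshift_def shift_by_orbit_closure)

end

theory Submission
  imports Defs "HOL-Number_Theory.Cong"
begin

text \<open>
  For \<open>v\<^sub>2(n) = k - 1\<close> we have \<open>\<eta>(n) = 0\<close> iff \<open>c\<^sub>j | n\<close> for some \<open>j < k\<close> or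
  \<open>c\<^sub>k\<^sup>2 | n\<close>. For each \<open>k\<close> the last condition may be replaced by \<open>c\<^sub>k\<^sup>2 | n + f\<^sub>k s\<^sub>k\<close>, where
  \<open>s\<^sub>k = 2\<^sup>k c\<^sub>1 \<dots> c\<^sub>k\<close>, independently of the other levels. The twisted points \<open>\<eta>\<^sub>f\<close> so obtained
  are limits of shifts of \<open>\<eta>\<close> by the Chinese remainder theorem, and shifts converging to
  \<open>\<eta>\<^sub>g\<close> carry \<open>\<eta>\<^sub>f\<close> to \<open>\<eta>\<^bsub>f+g\<^esub>\<close>. For finitely supported \<open>f\<close> the map \<open>\<eta> \<mapsto> \<eta>\<^sub>f\<close> is a sliding
  block code, because finitely many coordinates show whether a position lies on level \<open>k\<close>.
  The resulting automorphism depends only on \<open>f\<^sub>k\<close> modulo \<open>c\<^sub>k\<close>, and \<open>\<eta>\<^sub>f\<close> is a shift of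
  \<open>\<eta>\<close> only if all \<open>f\<^sub>k\<close> vanish modulo \<open>c\<^sub>k\<close>.
\<close>

section \<open>Integer divisibility and simultaneous congruences\<close>

lemma mult_dvd_iff_coprime:
  fixes a b n :: int
  assumes "coprime a b"
  shows "a * b dvd n \<longleftrightarrow> a dvd n \<and> b dvd n"
  using assms by (meson divides_mult dvd_mult_left dvd_mult_right)

lemma dvd_add_iff_of_dvd_diff:
  fixes d a b x :: int
  assumes "d dvd a - b"
  shows "d dvd a + x \<longleftrightarrow> d dvd b + x"
  using dvd_add_left_iff[of d "a - b" "b + x"] dvd_add_right_iff[OF assms, of "b + x"]
  by (simp add: algebra_simps)

text \<open>The freedom to place the solution in any interval as long as the product of the moduli
  is what later turns existence of a position into a test on a finite window.\<close>

lemma chinese_remainder_int_interval: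
  fixes m :: "'a \<Rightarrow> nat" and u :: "'a \<Rightarrow> int" and a :: int
  assumes fin: "finite A" and pos: "\<And>i. i \<in> A \<Longrightarrow> m i > 0"
    and cop: "\<And>i j. i \<in> A \<Longrightarrow> j \<in> A \<Longrightarrow> i \<noteq> j \<Longrightarrow> coprime (m i) (m j)"
  obtains x where "x \<in> {a..<a + int (\<Prod>i\<in>A. m i)}" "\<And>i. i \<in> A \<Longrightarrow> int (m i) dvd x - u i"
proof -
  let ?P = "int (\<Prod>i\<in>A. m i)"
  obtain y where y: "\<And>i. i \<in> A \<Longrightarrow> [y = nat (u i mod int (m i))] (mod m i)"
    using chinese_remainder_nat[OF fin, of m "\<lambda>i. nat (u i mod int (m i))"] cop by blast
  have P: "?P > 0"
    using pos by (simp add: prod_pos)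
  show ?thesis
  proof
    \<comment> \<open>This is the representative of \<open>y\<close> modulo \<open>?P\<close> in the
      interval starting at \<open>a\<close>.\<close>
    let ?x = "a + (int y - a) mod ?P"
    show "?x \<in> {a..<a + ?P}"
      using P by simp
    fix i assume i: "i \<in> A"
    have "int (m i) dvd ?P"
      using dvd_prodI[OF fin i, of m] by (simp only: int_dvd_int_iff)
    moreover have "?P dvd ?x - int y"
      using dvd_minus_mod[of ?P "int y - a"] by (subst dvd_diff_commute) (simp only: diff_diff_eq)
    moreover have "int (m i) dvd int y - u i"
    proof -
      have "[int y = int (nat (u i mod int (m i)))] (mod int (m i))"
        using y[OF i] cong_int_iff by blast
      also have "int (nat (u i mod int (m i))) = u i mod int (m i)"
        using pos[OF i] by simp
      also have "[u i mod int (m i) = u i] (mod int (m i))"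
        by simp
      finally show ?thesis
        by (simp add: cong_iff_dvd_diff)
    qed
    ultimately have "int (m i) dvd (?x - int y) + (int y - u i)"
      by (blast intro: dvd_add dvd_trans)
    also have "(?x - int y) + (int y - u i) = ?x - u i"
      by simp
    finally show "int (m i) dvd ?x - u i" .
  qed
qed

section \<open>Cylinder sets and finitely determined maps of the full shift\<close>

lemma open_cylinder:
  fixes x :: "int \<Rightarrow> bool"
  assumes "finite S"
  shows "open {y. \<forall>i\<in>S. y i = x i}"
  using product_topology_basis'[OF assms, of "\<lambda>i. {x i}" "\<lambda>i. i"] by (simp add: open_discrete)

lemma in_closure_cylinder:
  fixes x :: "int \<Rightarrow> bool"
  assumes "\<And>S. finite S \<Longrightarrow> \<exists>y\<in>A. \<forall>i\<in>S. y i = x i"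
  shows "x \<in> closure A"
proof -
  have "A \<inter> T \<noteq> {}" if T: "open T" "x \<in> T" for T
  proof -
    obtain U where U: "x \<in> Pi\<^sub>E UNIV U" "finite {i. U i \<noteq> UNIV}" "Pi\<^sub>E UNIV U \<subseteq> T"
      using product_topology_open_contains_basis[of "\<lambda>_. euclidean" UNIV T x] T
      by (auto simp: open_fun_def)
    obtain y where y: "y \<in> A" "\<forall>i\<in>{i. U i \<noteq> UNIV}. y i = x i"
      using assms[OF U(2)] by blast
    have "y i \<in> U i" for i
      using U(1) y(2) by (cases "U i = UNIV") (auto simp: PiE_iff)
    then have "y \<in> Pi\<^sub>E UNIV U"
      by (simp add: PiE_iff)
    with y(1) U(3) show ?thesis
      by blast
  qed
  then show ?thesis
    by (auto simp: closure_iff_nhds_not_empty)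
qed

text \<open>A combinatorial form of continuity: each output coordinate depends on finitely many
  input coordinates. Maps that also commute with the shift are the sliding block codes.\<close>

definition finitary :: "((int \<Rightarrow> bool) \<Rightarrow> (int \<Rightarrow> bool)) \<Rightarrow> bool"
  where "finitary F \<longleftrightarrow> (\<forall>n. \<exists>S. finite S \<and> (\<forall>x y. (\<forall>i\<in>S. x i = y i) \<longrightarrow> F x n = F y n))"

lemma finitary_continuous:
  assumes "finitary F"
  shows "continuous_on A F"
proof (rule continuous_on_coordinatewise_then_product)
  fix n
  obtain S where S: "finite S" "\<forall>x y. (\<forall>i\<in>S. x i = y i) \<longrightarrow> F x n = F y n"
    using assms unfolding finitary_def by blast
  have "open ((\<lambda>x. F x n) -` B)" for B
  proof (subst open_subopen, intro ballI)
    fix x assume x: "x \<in> (\<lambda>x. F x n) -` B"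
    have eq: "F y n = F x n" if "\<forall>i\<in>S. y i = x i" for y
      using S(2)[rule_format, of y x] that by simp
    have "{y. \<forall>i\<in>S. y i = x i} \<subseteq> (\<lambda>x. F x n) -` B"
    proof
      fix y assume "y \<in> {y. \<forall>i\<in>S. y i = x i}"
      then have "F y n = F x n"
        by (intro eq) simp
      then show "y \<in> (\<lambda>x. F x n) -` B"
        using x by simp
    qed
    then show "\<exists>T. open T \<and> x \<in> T \<and> T \<subseteq> (\<lambda>x. F x n) -` B"
      using open_cylinder[OF S(1), of x] by blast
  qed
  then have "continuous_on UNIV (\<lambda>x. F x n)"
    by (simp add: continuous_on_open_vimage)
  then show "continuous_on A (\<lambda>x. F x n)"
    by (rule continuous_on_subset) simp
qed

text \<open>Both values at \<open>n\<close> depend only on finitely many coordinates, and there some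
  point of \<open>A\<close> agrees with \<open>x\<close>.\<close>

lemma finitary_eq_on_closure:
  assumes F: "finitary F" and G: "finitary G" and eq: "\<And>x. x \<in> A \<Longrightarrow> F x = G x" and x: "x \<in> closure A"
  shows "F x = G x"
proof
  fix n
  obtain S where S: "finite S" "\<forall>x y. (\<forall>i\<in>S. x i = y i) \<longrightarrow> F x n = F y n"
    using F unfolding finitary_def by blast
  obtain T where T: "finite T" "\<forall>x y. (\<forall>i\<in>T. x i = y i) \<longrightarrow> G x n = G y n"
    using G unfolding finitary_def by blast
  have "open {y. \<forall>i\<in>S \<union> T. y i = x i}"
    using S T by (intro open_cylinder) auto
  moreover have "x \<in> {y. \<forall>i\<in>S \<union> T. y i = x i}"
    by simp
  ultimately obtain y where y: "y \<in> A" "\<forall>i\<in>S \<union> T. y i = x i"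
    using x unfolding closure_iff_nhds_not_empty by blast
  then show "F x n = G x n"
    using S(2)[rule_format, of x y] T(2)[rule_format, of x y] eq by auto
qed

lemma finitary_compose:
  assumes F: "finitary F" and G: "finitary G"
  shows "finitary (\<lambda>x. F (G x))"
  unfolding finitary_def
proof
  fix n
  obtain S where S: "finite S" "\<forall>x y. (\<forall>i\<in>S. x i = y i) \<longrightarrow> F x n = F y n"
    using F unfolding finitary_def by blast
  obtain T where T: "\<And>i. finite (T i)"
      "\<And>i x y. (\<And>j. j \<in> T i \<Longrightarrow> x j = y j) \<Longrightarrow> G x i = G y i"
    using G unfolding finitary_def by metis
  have "F (G x) n = F (G y) n" if "\<forall>i\<in>\<Union>(T ` S). x i = y i" for x y
    using that by (intro S(2)[rule_format] T(2)) blast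
  then show "\<exists>S. finite S \<and> (\<forall>x y. (\<forall>i\<in>S. x i = y i) \<longrightarrow> F (G x) n = F (G y) n)"
    using S(1) T(1) by (intro exI[of _ "\<Union>(T ` S)"]) blast
qed

section \<open>Twisted points and their levels\<close>

locale odd_coprime_seq =
  fixes c :: "nat \<Rightarrow> nat"
  assumes odd_c: "k \<ge> 1 \<Longrightarrow> odd (c k)" and c_gt_1: "k \<ge> 1 \<Longrightarrow> c k > 1"
    and coprime_c: "i \<ge> 1 \<Longrightarrow> j \<ge> 1 \<Longrightarrow> i \<noteq> j \<Longrightarrow> coprime (c i) (c j)"
begin

abbreviation C :: "nat \<Rightarrow> int"
  where "C k \<equiv> int (c k)"

text \<open>
  Adding \<open>step k\<close> preserves divisibility by \<open>2\<^sup>k\<close> and by \<open>c\<^sub>1, \<dots>, c\<^sub>k\<close>; among the conditions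
  at level \<open>k\<close> it affects only divisibility by \<open>c\<^sub>k\<^sup>2\<close>.
\<close>

definition step :: "nat \<Rightarrow> int"
  where "step k = 2 ^ k * (\<Prod>j\<in>{1..k}. C j)"

definition twist :: "(nat \<Rightarrow> int) \<Rightarrow> int \<Rightarrow> bool"
  where "twist f n \<longleftrightarrow>
    (\<forall>k\<ge>1. \<not> 2 ^ k * C k dvd n \<and> \<not> 2 ^ (k - 1) * (C k)\<^sup>2 dvd n + f k * step k)"

lemma eta_eq_twist: "eta (B1_infty c) = twist (\<lambda>_. 0)"
proof
  fix n
  have "eta (B1_infty c) n \<longleftrightarrow> (\<forall>b\<in>B1_infty c. \<not> int b dvd n)"
    by (auto simp: eta_def dvd_def)
  also have "\<dots> \<longleftrightarrow> twist (\<lambda>_. 0) n"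
    unfolding twist_def B1_infty_def
    by (simp add: ball_Un) (fastforce simp: Ball_def)
  finally show "eta (B1_infty c) n = twist (\<lambda>_. 0) n" .
qed

lemma coprime_two_power: "k \<ge> 1 \<Longrightarrow> coprime (2 ^ i) (C k)"
  using odd_c[of k] by simp

lemma two_power_dvd_step: "i \<le> k \<Longrightarrow> 2 ^ i dvd step k"
  unfolding step_def by (intro dvd_mult2 le_imp_power_dvd)

lemma C_dvd_step: "1 \<le> j \<Longrightarrow> j \<le> k \<Longrightarrow> C j dvd step k"
  unfolding step_def by (intro dvd_mult dvd_prodI) auto

text \<open>Separating the levels \<open>v\<^sub>2(n) = k - 1\<close>: the twist \<open>f k\<close> matters only there.\<close>

lemma twist_iff:
  "twist f n \<longleftrightarrow> (\<forall>k\<ge>1. \<not> (2 ^ k dvd n \<and> C k dvd n) \<and>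
     \<not> (2 ^ (k - 1) dvd n \<and> \<not> 2 ^ k dvd n \<and> (C k)\<^sup>2 dvd n + f k * step k))"
proof -
  have "2 ^ k * C k dvd n \<longleftrightarrow> 2 ^ k dvd n \<and> C k dvd n"
    and "2 ^ (k - 1) * (C k)\<^sup>2 dvd n + f k * step k \<longleftrightarrow>
      2 ^ (k - 1) dvd n \<and> (C k)\<^sup>2 dvd n + f k * step k"
    and "(C k)\<^sup>2 dvd n + f k * step k \<Longrightarrow> C k dvd n" if k: "k \<ge> 1" for k
  proof -
    show "2 ^ k * C k dvd n \<longleftrightarrow> 2 ^ k dvd n \<and> C k dvd n"
      using coprime_two_power[OF k] by (rule mult_dvd_iff_coprime)
    have d: "2 ^ (k - 1) dvd f k * step k"
      by (intro dvd_mult two_power_dvd_step) simp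
    have co: "coprime (2 ^ (k - 1)) ((C k)\<^sup>2)"
      by (metis coprime_power_right_iff coprime_two_power[OF k])
    show "2 ^ (k - 1) * (C k)\<^sup>2 dvd n + f k * step k \<longleftrightarrow>
      2 ^ (k - 1) dvd n \<and> (C k)\<^sup>2 dvd n + f k * step k"
      by (simp only: mult_dvd_iff_coprime[OF co] dvd_add_left_iff[OF d])
    assume "(C k)\<^sup>2 dvd n + f k * step k"
    then have "C k dvd n + f k * step k"
      by (metis dvd_mult_left power2_eq_square)
    moreover have "C k dvd f k * step k"
      using C_dvd_step[OF k] by simp
    ultimately show "C k dvd n"
      by (simp add: dvd_add_left_iff)
  qed
  then show ?thesis
    unfolding twist_def by metis
qed

text \<open>Since \<open>step k\<close> is a multiple of \<open>C k\<close>, changing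
  \<open>f k\<close> by a multiple of \<open>C k\<close> moves \<open>f k * step k\<close> by a
  multiple of \<open>(C k)\<^sup>2\<close>. So the parameter \<open>f k\<close> lives in the
  integers modulo \<open>c k\<close>.\<close>

lemma twist_cong:
  assumes "\<And>k. k \<ge> 1 \<Longrightarrow> C k dvd f k - g k"
  shows "twist f = twist g"
proof -
  have "(C k)\<^sup>2 dvd n + f k * step k \<longleftrightarrow> (C k)\<^sup>2 dvd n + g k * step k" if k: "k \<ge> 1" for k n
  proof -
    have "(C k)\<^sup>2 dvd (f k - g k) * step k"
      unfolding power2_eq_square using assms[OF k] C_dvd_step[OF k] by (simp add: mult_dvd_mono)
    then have "(C k)\<^sup>2 dvd f k * step k - g k * step k"
      by (simp add: algebra_simps)
    then show ?thesis
      using dvd_add_iff_of_dvd_diff[of _ "f k * step k" "g k * step k" n] by (simp add: add.commute)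
  qed
  then show ?thesis
    unfolding fun_eq_iff twist_iff by metis
qed

section \<open>Positions with prescribed residues, and approximation by shifts\<close>

text \<open>Index 0 carries the power of two; the indices from 1 on carry the squares.\<close>

definition crt_modulus :: "nat \<Rightarrow> nat \<Rightarrow> nat"
  where "crt_modulus K i = (if i = 0 then 2 ^ K else (c i)\<^sup>2)"

definition window :: "nat \<Rightarrow> int"
  where "window K = int (\<Prod>i\<in>{0..K}. crt_modulus K i)"

lemma crt:
  fixes u :: "nat \<Rightarrow> int"
  obtains x where "x \<in> {a..<a + window K}" "2 ^ K dvd x - u 0"
    "\<And>k. 1 \<le> k \<Longrightarrow> k \<le> K \<Longrightarrow> (C k)\<^sup>2 dvd x - u k"
proof -
  have pos: "crt_modulus K i > 0" for i
    using c_gt_1[of i] by (cases "i = 0") (auto simp: crt_modulus_def)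
  have cop: "coprime (crt_modulus K i) (crt_modulus K j)" if "i \<noteq> j" for i j
    using that odd_c[of i] odd_c[of j] coprime_c[of i j]
    by (auto simp: crt_modulus_def coprime_commute[of "_\<^sup>2" "2 ^ _"])
  obtain x where x: "x \<in> {a..<a + window K}"
      "\<And>i. i \<in> {0..K} \<Longrightarrow> int (crt_modulus K i) dvd x - u i"
    using chinese_remainder_int_interval[of "{0..K}" "crt_modulus K" a u] pos cop
    unfolding window_def by blast
  show ?thesis
  proof (rule that[OF x(1)])
    show "2 ^ K dvd x - u 0"
      using x(2)[of 0] by (simp add: crt_modulus_def)
    show "(C k)\<^sup>2 dvd x - u k" if "1 \<le> k" "k \<le> K" for k
      using x(2)[of k] that by (simp add: crt_modulus_def)
  qed
qed

text \<open>The number \<open>t\<close> imitates \<open>g k * step k\<close> modulo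
  \<open>(C k)\<^sup>2\<close> at all levels that occur in \<open>S\<close>, and is divisible by a
  power of two so high that it preserves these levels. It is independent of \<open>f\<close>: zero
  \<open>f\<close> gives approximation of twisted points by shifts of eta, general \<open>f\<close>
  lets the same shift act on all twists.\<close>

lemma twist_add_approx:
  assumes "finite S"
  obtains t where "\<And>f n. n \<in> S \<Longrightarrow> twist (\<lambda>k. f k + g k) n = twist f (n + t)"
proof -
  \<comment> \<open>Nonzero elements of \<open>S\<close> are then not divisible by
    \<open>2 ^ V\<close>, so they lie on levels up to \<open>V\<close>.\<close>
  obtain V where V: "V \<ge> 1" "\<And>n. n \<in> S \<Longrightarrow> \<bar>n\<bar> < 2 ^ V"
  proof
    let ?V = "Suc (nat (\<Sum>n\<in>S. \<bar>n\<bar>))"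
    fix n assume "n \<in> S"
    then have "\<bar>n\<bar> \<le> (\<Sum>n\<in>S. \<bar>n\<bar>)"
      using assms by (intro member_le_sum) auto
    also have "\<dots> < int ?V"
      by linarith
    also have "\<dots> < 2 ^ ?V"
      using of_nat_less_two_power by blast
    finally show "\<bar>n\<bar> < 2 ^ ?V" .
  qed simp
  define u where "u k = (if k = 0 then 0 else g k * step k)" for k
  obtain t where t: "2 ^ V dvd t - u 0" "\<And>k. 1 \<le> k \<Longrightarrow> k \<le> V \<Longrightarrow> (C k)\<^sup>2 dvd t - u k"
    using crt[of 0 V u] by blast
  have t0: "2 ^ V dvd t"
    using t(1) by (simp add: u_def)
  have t1: "(C k)\<^sup>2 dvd t - g k * step k" if "1 \<le> k" "k \<le> V" for k
    using t(2)[of k] that by (simp add: u_def)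
  have two: "2 ^ k dvd t" if "k \<le> V" for k
    using t0 that power_le_dvd by blast
  have Ct: "C k dvd t" if k: "1 \<le> k" "k \<le> V" for k
  proof -
    have "C k dvd t - g k * step k"
      using t1[OF k] by (metis dvd_mult_left power2_eq_square)
    moreover have "C k dvd g k * step k"
      using C_dvd_step[OF k(1)] by simp
    ultimately show ?thesis
      by (simp add: dvd_diff_left_iff)
  qed
  show ?thesis
  proof
    fix f n assume n: "n \<in> S"
    show "twist (\<lambda>k. f k + g k) n = twist f (n + t)"
    \<comment> \<open>Zero lies on no level. Both sides are false there, already by the condition
      \<open>k = 1\<close>, as 2 and \<open>C 1\<close> divide \<open>t\<close>; this uses
      \<open>V \<ge> 1\<close>.\<close>
    proof (cases "n = 0")
      case True
      then have "\<not> twist (\<lambda>k. f k + g k) n"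
        unfolding twist_iff by auto
      moreover have "\<not> twist f (n + t)"
        using two[of 1] Ct[of 1] V(1) True unfolding twist_iff by auto
      ultimately show ?thesis
        by simp
    next
      case False
      then have nV: "\<not> 2 ^ V dvd n"
        using V(2)[OF n] zdvd_imp_le[of "2 ^ V" "\<bar>n\<bar>"] by auto
      have nV': "\<not> 2 ^ k dvd n" if "V \<le> k" for k
        using nV that power_le_dvd by blast
      have ntV: "\<not> 2 ^ k dvd n + t" if "V \<le> k" for k
        using nV that t0 power_le_dvd[of 2 k "n + t" V] by (auto simp: dvd_add_left_iff)
      have "(2 ^ k dvd n \<and> C k dvd n \<longleftrightarrow> 2 ^ k dvd n + t \<and> C k dvd n + t) \<and>
         (2 ^ (k - 1) dvd n \<and> \<not> 2 ^ k dvd n \<and> (C k)\<^sup>2 dvd n + (f k + g k) * step k \<longleftrightarrow>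
          2 ^ (k - 1) dvd n + t \<and> \<not> 2 ^ k dvd n + t \<and> (C k)\<^sup>2 dvd n + t + f k * step k)"
        if k: "k \<ge> 1" for k
      proof (cases "k \<le> V")
        case True
        have "(C k)\<^sup>2 dvd n + (f k + g k) * step k \<longleftrightarrow> (C k)\<^sup>2 dvd n + t + f k * step k"
          using dvd_add_iff_of_dvd_diff[OF t1[OF k True], of "n + f k * step k"]
          by (simp add: algebra_simps)
        then show ?thesis
          using True two[of k] two[of "k - 1"] Ct[OF k True] by (simp add: dvd_add_left_iff)
      \<comment> \<open>Beyond \<open>V\<close> neither \<open>n\<close> nor \<open>n + t\<close> is
        divisible by \<open>2 ^ (k - 1)\<close>, so the conditions are void.\<close>
      next
        case False
        then have "V \<le> k" "V \<le> k - 1"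
          by auto
        then show ?thesis
          using nV' ntV by blast
      qed
      then show ?thesis
        unfolding twist_iff by blast
    qed
  qed
qed

text \<open>Off the multiples of \<open>2 ^ K\<close>, no residue class modulo
  \<open>2 ^ K * C K\<close> consists of zeros of a twisted point, and a one is found in every
  window.\<close>

lemma twist_somewhere:
  assumes K: "K \<ge> 1" and u: "\<not> 2 ^ K dvd u"
  obtains n where "n \<in> {a..<a + window K}" "2 ^ K dvd n - u" "C K dvd n - b" "twist g n"
proof -
  \<comment> \<open>Lift \<open>b\<close> to a residue modulo \<open>(C K)\<^sup>2\<close> that
    avoids the forbidden one: \<open>b\<close> and \<open>b + C K\<close> cannot both be
    forbidden.\<close>
  obtain w where w: "C K dvd w - b" "\<not> (C K)\<^sup>2 dvd w + g K * step K"
  proof (cases "(C K)\<^sup>2 dvd b + g K * step K")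
    case True
    have "\<not> (C K)\<^sup>2 dvd C K"
    proof
      assume "(C K)\<^sup>2 dvd C K"
      then have "C K * C K dvd C K * 1"
        by (simp add: power2_eq_square)
      then show False
        using c_gt_1[OF K] by (subst (asm) dvd_mult_cancel_left) auto
    qed
    then have "\<not> (C K)\<^sup>2 dvd (b + g K * step K) + C K"
      using True by (simp add: dvd_add_right_iff)
    then show ?thesis
      by (intro that[of "b + C K"]) (simp_all add: algebra_simps)
  next
    case False
    then show ?thesis
      by (intro that[of b]) auto
  qed
  \<comment> \<open>The residue 1 at the other indices keeps \<open>n\<close> prime to
    \<open>C k\<close> for \<open>k < K\<close>; conditions above \<open>K\<close> fail because
    \<open>2 ^ K\<close> does not divide \<open>n\<close>.\<close>
  define v where "v k = (if k = 0 then u else if k = K then w else 1)" for k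
  obtain n where n: "n \<in> {a..<a + window K}" "2 ^ K dvd n - v 0"
      "\<And>k. 1 \<le> k \<Longrightarrow> k \<le> K \<Longrightarrow> (C k)\<^sup>2 dvd n - v k"
    using crt[of a K v] by blast
  have nu: "2 ^ K dvd n - u"
    using n(2) by (simp add: v_def)
  have nw: "(C K)\<^sup>2 dvd n - w"
    using n(3)[of K] K by (simp add: v_def)
  have nK: "\<not> 2 ^ k dvd n" if "K \<le> k" for k
  proof
    assume "2 ^ k dvd n"
    then have "2 ^ K dvd n"
      using that power_le_dvd by blast
    then show False
      using u dvd_diff_right_iff[of "2 ^ K" n u] nu by blast
  qed
  have unit: "\<not> C k dvd n" if "1 \<le> k" "k < K" for k
  proof
    assume d: "C k dvd n"
    have "(C k)\<^sup>2 dvd n - 1"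
      using n(3)[of k] that by (simp add: v_def)
    then have "C k dvd n - 1"
      by (metis dvd_mult_left power2_eq_square)
    with d have "C k dvd 1"
      using dvd_diff_right_iff[of "C k" n 1] by blast
    then show False
      using c_gt_1[of k] that by simp
  qed
  have "twist g n"
    unfolding twist_def
  proof (intro allI impI conjI notI)
    fix k :: nat assume k: "k \<ge> 1"
    {
      assume "2 ^ k * C k dvd n"
      then have "2 ^ k dvd n" "C k dvd n"
        using dvd_mult_left dvd_mult_right by blast+
      then show False
        using nK[of k] unit[of k] k by (cases "k < K") auto
    next
      assume *: "2 ^ (k - 1) * (C k)\<^sup>2 dvd n + g k * step k"
      then have 1: "2 ^ (k - 1) dvd n + g k * step k" and 2: "(C k)\<^sup>2 dvd n + g k * step k"
        using dvd_mult_left dvd_mult_right by blast+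
      from 1 have "2 ^ (k - 1) dvd n"
        using two_power_dvd_step[of "k - 1" k] by (simp add: dvd_add_left_iff)
      then have "\<not> K \<le> k - 1"
        using nK by blast
      then have "k \<le> K"
        by simp
      moreover have "k \<noteq> K"
        using 2 w(2) dvd_add_iff_of_dvd_diff[OF nw] by auto
      moreover have "C k dvd n"
        using 2 C_dvd_step[OF k order_refl] dvd_mult_left[of "C k" "C k"]
        by (simp add: power2_eq_square dvd_add_left_iff) (metis dvd_add_left_iff dvd_mult)
      ultimately show False
        using unit[of k] k by auto
    }
  qed
  moreover have "C K dvd n - b"
  proof -
    have "C K dvd n - w"
      using nw by (metis dvd_mult_left power2_eq_square)
    from dvd_add[OF this w(1)] show ?thesis
      by simp
  qed
  ultimately show ?thesis
    using that n(1) nu by blast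
qed

section \<open>Recognizing levels from a finite window\<close>

text \<open>A level is a single residue class: the quotient of \<open>n\<close> by
  \<open>2 ^ (k - 1)\<close> must be odd.\<close>

lemma two_power_dvd_shifted:
  fixes n :: int
  assumes "k \<ge> 1"
  shows "2 ^ k dvd n + 2 ^ (k - 1) \<longleftrightarrow> 2 ^ (k - 1) dvd n \<and> \<not> 2 ^ k dvd n"
proof -
  obtain j where k: "k = Suc j"
    using assms by (cases k) auto
  show ?thesis
  proof (cases "2 ^ j dvd n")
    case True
    then obtain q where "n = 2 ^ j * q"
      by blast
    then have "2 ^ k dvd n + 2 ^ (k - 1) \<longleftrightarrow> 2 ^ j * 2 dvd 2 ^ j * (q + 1)"
      and "2 ^ k dvd n \<longleftrightarrow> 2 ^ j * 2 dvd 2 ^ j * q"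
      by (simp_all add: k algebra_simps)
    then show ?thesis
      using True by (simp add: k)
  next
    case False
    have "2 ^ j dvd n" if "2 ^ k dvd n + 2 ^ j"
    proof -
      have "2 ^ j dvd n + 2 ^ j"
        using that by (rule power_le_dvd) (simp add: k)
      then show ?thesis
        by (simp add: dvd_add_left_iff)
    qed
    then show ?thesis
      using False by (auto simp: k)
  qed
qed

text \<open>
  A residue class modulo \<open>2\<^sup>K c\<^sub>K\<close> on which a point of the subshift vanishes must lie over
  the class of \<open>0\<close> modulo \<open>2\<^sup>K\<close>, so the position modulo \<open>2\<^sup>K\<close> can be read off a finite window.
\<close>

definition at_level :: "nat \<Rightarrow> (int \<Rightarrow> bool) \<Rightarrow> bool"
  where "at_level K x \<longleftrightarrow>
    (\<exists>e. \<forall>m\<in>{0..<window K}. 2 ^ K dvd m - 2 ^ (K - 1) \<and> C K dvd m - e \<longrightarrow> \<not> x m)"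

text \<open>On level \<open>K\<close>, translation by \<open>u\<close> carries the class of
  \<open>2 ^ (K - 1)\<close> to multiples of \<open>2 ^ K\<close>, and \<open>e = - u\<close>
  selects the multiples of \<open>C K\<close> among them, which are zeros. Otherwise the translated
  class is not that of 0, and \<open>twist_somewhere\<close> finds a one for every
  \<open>e\<close>.\<close>

lemma at_level_twist:
  assumes K: "K \<ge> 1"
  shows "at_level K (shift_by u (twist g)) \<longleftrightarrow> 2 ^ (K - 1) dvd u \<and> \<not> 2 ^ K dvd u"
  unfolding two_power_dvd_shifted[OF K, symmetric]
proof
  assume *: "2 ^ K dvd u + 2 ^ (K - 1)"
  show "at_level K (shift_by u (twist g))"
    unfolding at_level_def
  proof (intro exI[of _ "- u"] ballI impI)
    fix m assume "2 ^ K dvd m - 2 ^ (K - 1) \<and> C K dvd m - - u"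
    then have "2 ^ K dvd (m - 2 ^ (K - 1)) + (u + 2 ^ (K - 1))" and "C K dvd m + u"
      using dvd_add[OF _ *] by (blast, simp)
    then have "2 ^ K dvd m + u" "C K dvd m + u"
      by simp_all
    then show "\<not> shift_by u (twist g) m"
      using K unfolding twist_iff shift_by_def by blast
  qed
next
  assume "at_level K (shift_by u (twist g))"
  then obtain e where e: "\<And>m. m \<in> {0..<window K} \<Longrightarrow> 2 ^ K dvd m - 2 ^ (K - 1) \<Longrightarrow>
      C K dvd m - e \<Longrightarrow> \<not> twist g (m + u)"
    unfolding at_level_def shift_by_def by blast
  show "2 ^ K dvd u + 2 ^ (K - 1)"
  proof (rule ccontr)
    assume "\<not> 2 ^ K dvd u + 2 ^ (K - 1)"
    then obtain n where n: "n \<in> {u..<u + window K}" "2 ^ K dvd n - (u + 2 ^ (K - 1))"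
        "C K dvd n - (e + u)" "twist g n"
      by (rule twist_somewhere[OF K])
    then show False
      using e[of "n - u"] by (auto simp: algebra_simps)
  qed
qed

section \<open>The sliding block codes that add twists\<close>

text \<open>On shifts of twisted points at most one level is detected, so the sum has at most one
  nonzero term; as a sum it makes sense for every sequence. For infinite support it is 0 by
  convention, and the map is the identity.\<close>

definition twist_map :: "(nat \<Rightarrow> int) \<Rightarrow> (int \<Rightarrow> bool) \<Rightarrow> (int \<Rightarrow> bool)"
  where "twist_map f x = (\<lambda>n. x (n + (\<Sum>k | k \<ge> 1 \<and> f k \<noteq> 0.
    if at_level k (shift_by n x) then f k * step k else 0)))"

lemma twist_map_shift_by: "twist_map f (shift_by i x) = shift_by i (twist_map f x)"
  by (simp add: twist_map_def shift_by_def algebra_simps)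

lemma finitary_twist_map:
  assumes "finite {k. k \<ge> 1 \<and> f k \<noteq> 0}"
  shows "finitary (twist_map f)"
  unfolding finitary_def
proof
  fix n
  let ?A = "{k. k \<ge> 1 \<and> f k \<noteq> 0}"
  \<comment> \<open>The windows decide the levels. The remaining coordinates are all possible
    reading positions, one for each set of detected levels, since an arbitrary sequence may show
    several at once.\<close>
  define S where "S = (\<Union>k\<in>?A. {n..<n + window k}) \<union>
    (\<lambda>B. n + (\<Sum>k\<in>B. f k * step k)) ` Pow ?A"
  have eq: "twist_map f x n = twist_map f y n" if xy: "\<And>i. i \<in> S \<Longrightarrow> x i = y i" for x y
  proof -
    have lev: "at_level k (shift_by n x) = at_level k (shift_by n y)" if "k \<in> ?A" for k
    proof -
      have "shift_by n x m = shift_by n y m" if "m \<in> {0..<window k}" for m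
        using that \<open>k \<in> ?A\<close> unfolding shift_by_def by (intro xy) (auto simp: S_def)
      then show ?thesis
        unfolding at_level_def by metis
    qed
    let ?B = "{k \<in> ?A. at_level k (shift_by n y)}"
    have "(\<Sum>k\<in>?A. if at_level k (shift_by n x) then f k * step k else 0) =
        (\<Sum>k\<in>?A. if at_level k (shift_by n y) then f k * step k else 0)"
      by (rule sum.cong) (simp_all add: lev)
    moreover have "\<dots> = (\<Sum>k\<in>?B. f k * step k)"
      using assms by (rule sum.inter_filter[symmetric])
    moreover have "x (n + (\<Sum>k\<in>?B. f k * step k)) = y (n + (\<Sum>k\<in>?B. f k * step k))"
      by (rule xy) (auto simp: S_def)
    ultimately show ?thesis
      unfolding twist_map_def by simp
  qed
  have "finite S"
    using assms by (simp add: S_def)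
  then show "\<exists>S. finite S \<and> (\<forall>x y. (\<forall>i\<in>S. x i = y i) \<longrightarrow> twist_map f x n = twist_map f y n)"
    by (intro exI[of _ S] conjI allI impI eq) auto
qed

text \<open>Moving a position on level \<open>l\<close> by a multiple of \<open>step l\<close> keeps
  its level and its divisibility by \<open>C j\<close> for \<open>j \<le> l\<close>; only the test
  modulo \<open>(C l)\<^sup>2\<close> changes, exactly as in \<open>twist f\<close>.\<close>

lemma twist_map_eta:
  assumes fin: "finite {k. k \<ge> 1 \<and> f k \<noteq> 0}"
  shows "twist_map f (twist (\<lambda>_. 0)) = twist f"
proof
  fix n
  let ?A = "{k. k \<ge> 1 \<and> f k \<noteq> 0}"
  let ?s = "\<Sum>k\<in>?A. if at_level k (shift_by n (twist (\<lambda>_. 0))) then f k * step k else 0"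
  have s: "?s = (\<Sum>k\<in>?A. if 2 ^ (k - 1) dvd n \<and> \<not> 2 ^ k dvd n then f k * step k else 0)"
    by (rule sum.cong) (simp_all add: at_level_twist)
  show "twist_map f (twist (\<lambda>_. 0)) n = twist f n"
  proof (cases "\<exists>k\<in>?A. 2 ^ (k - 1) dvd n \<and> \<not> 2 ^ k dvd n")
    case False
    then have "?s = 0"
      unfolding s by (intro sum.neutral) auto
    moreover have "twist (\<lambda>_. 0) n = twist f n"
      unfolding twist_iff using False by auto (metis add.right_neutral mult_zero_left)+
    ultimately show ?thesis
      by (simp add: twist_map_def)
  next
    case True
    then obtain l where l: "l \<ge> 1" "f l \<noteq> 0" "2 ^ (l - 1) dvd n" "\<not> 2 ^ l dvd n"
      by blast
    have uniq: "2 ^ (k - 1) dvd n \<and> \<not> 2 ^ k dvd n \<longleftrightarrow> k = l" if "k \<ge> 1" for k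
    proof (cases k l rule: linorder_cases)
      case less
      then have "k \<le> l - 1"
        by simp
      then have "2 ^ k dvd n"
        using l(3) power_le_dvd by blast
      then show ?thesis
        using less by simp
    next
      case greater
      then have "l \<le> k - 1"
        by simp
      then have "\<not> 2 ^ (k - 1) dvd n"
        using l(4) power_le_dvd by blast
      then show ?thesis
        using greater by simp
    qed (use l in auto)
    have "?s = (\<Sum>k\<in>?A. if k = l then f k * step k else 0)"
      unfolding s by (intro sum.cong if_cong refl) (use uniq in blast)
    also have "\<dots> = f l * step l"
      using fin l by (simp add: sum.delta)
    finally have s': "?s = f l * step l" .
    have two: "2 ^ k dvd n + f l * step l \<longleftrightarrow> 2 ^ k dvd n" if "k \<le> l" for k
      using two_power_dvd_step[OF that] by (simp add: dvd_add_left_iff)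
    have big: "\<not> 2 ^ k dvd n + f l * step l" "\<not> 2 ^ k dvd n" if "k \<ge> l" for k
      using two[of l] l(4) power_le_dvd[OF _ that] by blast+
    \<comment> \<open>The summand \<open>0 * step k\<close> keeps the shape of
      \<open>twist_iff\<close> for the zero twist.\<close>
    have "(2 ^ k dvd n + f l * step l \<and> C k dvd n + f l * step l \<longleftrightarrow> 2 ^ k dvd n \<and> C k dvd n) \<and>
       (2 ^ (k - 1) dvd n + f l * step l \<and> \<not> 2 ^ k dvd n + f l * step l \<and>
          (C k)\<^sup>2 dvd n + f l * step l + 0 * step k \<longleftrightarrow>
        2 ^ (k - 1) dvd n \<and> \<not> 2 ^ k dvd n \<and> (C k)\<^sup>2 dvd n + f k * step k)"
      if k: "k \<ge> 1" for k
    proof (cases k l rule: linorder_cases)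
      case less
      have "C k dvd n + f l * step l \<longleftrightarrow> C k dvd n"
        using C_dvd_step[of k l] less k by (simp add: dvd_add_left_iff)
      moreover have "2 ^ k dvd n"
        using uniq[OF k] less l(3) power_le_dvd[of 2 "l - 1" n k] by simp
      ultimately show ?thesis
        using two[of k] less by simp
    next
      case equal
      then show ?thesis
        using big[of k] two[of "k - 1"] by simp
    next
      case greater
      then show ?thesis
        using big[of k] big[of "k - 1"] by simp
    qed
    then have "twist (\<lambda>_. 0) (n + f l * step l) = twist f n"
      unfolding twist_iff by blast
    then show ?thesis
      using s' by (simp add: twist_map_def)
  qed
qed

text \<open>On the finitely many coordinates that matter, \<open>twist g\<close> is a shift of eta
  by some \<open>t\<close>. The code commutes with this shift, and the same \<open>t\<close> turns
  \<open>twist f\<close> into the sum twist at \<open>n\<close>.\<close>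

lemma twist_map_twist:
  assumes fin: "finite {k. k \<ge> 1 \<and> f k \<noteq> 0}"
  shows "twist_map f (twist g) = twist (\<lambda>k. f k + g k)"
proof
  fix n
  obtain S where S: "finite S"
      "\<forall>x y. (\<forall>i\<in>S. x i = y i) \<longrightarrow> twist_map f x n = twist_map f y n"
    using finitary_twist_map[OF fin] unfolding finitary_def by blast
  obtain t where t: "\<And>f i. i \<in> insert n S \<Longrightarrow> twist (\<lambda>k. f k + g k) i = twist f (i + t)"
    using twist_add_approx[of "insert n S" g] S(1) by auto
  have "twist_map f (twist g) n = twist_map f (shift_by t (twist (\<lambda>_. 0))) n"
    using t[of _ "\<lambda>_. 0"] by (intro S(2)[rule_format]) (simp add: shift_by_def)
  also have "\<dots> = twist f (n + t)"
    by (simp add: twist_map_shift_by twist_map_eta[OF fin]) (simp add: shift_by_def)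
  also have "\<dots> = twist (\<lambda>k. f k + g k) n"
    using t[of n f] by simp
  finally show "twist_map f (twist g) n = twist (\<lambda>k. f k + g k) n" .
qed

section \<open>Automorphisms of the subshift\<close>

abbreviation X :: "(int \<Rightarrow> bool) set"
  where "X \<equiv> free_subshift (B1_infty c)"

lemma X_eq: "X = closure (range (\<lambda>i. shift_by i (twist (\<lambda>_. 0))))"
  by (simp add: free_subshift_def orbit_closure_def eta_eq_twist)

sublocale shift_invariant X
  by (rule shift_invariant_free_subshift)

lemma twist_in_X: "twist g \<in> X"
  unfolding X_eq
proof (rule in_closure_cylinder)
  fix S :: "int set" assume "finite S"
  then obtain t where "\<And>f n. n \<in> S \<Longrightarrow> twist (\<lambda>k. f k + g k) n = twist f (n + t)"
    using twist_add_approx by blast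
  from this[of _ "\<lambda>_. 0"]
  have "\<forall>n\<in>S. shift_by t (twist (\<lambda>_. 0)) n = twist g n"
    by (simp add: shift_by_def)
  then show "\<exists>y\<in>range (\<lambda>i. shift_by i (twist (\<lambda>_. 0))). \<forall>i\<in>S. y i = twist g i"
    by blast
qed

lemma eq_on_X:
  assumes "finitary F" "finitary G" "\<And>i. F (shift_by i (twist (\<lambda>_. 0))) = G (shift_by i (twist (\<lambda>_. 0)))"
    and "x \<in> X"
  shows "F x = G x"
  using finitary_eq_on_closure[OF assms(1,2), of "range (\<lambda>i. shift_by i (twist (\<lambda>_. 0)))"] assms(3,4)
  unfolding X_eq by blast

lemma twist_map_in_X:
  assumes "finite {k. k \<ge> 1 \<and> f k \<noteq> 0}"
  shows "twist_map f ` X \<subseteq> X"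
proof -
  have "twist_map f ` closure (range (\<lambda>i. shift_by i (twist (\<lambda>_. 0)))) \<subseteq> X"
  proof (rule image_closure_subset[OF finitary_continuous[OF finitary_twist_map[OF assms]]])
    show "closed X"
      by (simp add: X_eq)
    show "twist_map f ` range (\<lambda>i. shift_by i (twist (\<lambda>_. 0))) \<subseteq> X"
      using twist_in_X shift_in by (auto simp: twist_map_shift_by twist_map_eta[OF assms])
  qed
  then show ?thesis
    by (simp add: X_eq)
qed

text \<open>Both sides agree on the orbit of eta by \<open>twist_cong\<close>, hence on its closure.
  The congruence form covers both inverses and reduction modulo \<open>c k\<close>.\<close>

lemma twist_map_add:
  assumes f: "finite {k. k \<ge> 1 \<and> f k \<noteq> 0}" and g: "finite {k. k \<ge> 1 \<and> g k \<noteq> 0}"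
    and h: "finite {k. k \<ge> 1 \<and> h k \<noteq> 0}"
    and fgh: "\<And>k. k \<ge> 1 \<Longrightarrow> C k dvd f k + g k - h k" and x: "x \<in> X"
  shows "twist_map f (twist_map g x) = twist_map h x"
proof (rule eq_on_X[OF _ _ _ x])
  show "finitary (\<lambda>x. twist_map f (twist_map g x))" "finitary (twist_map h)"
    using finitary_compose[OF finitary_twist_map[OF f] finitary_twist_map[OF g]]
      finitary_twist_map[OF h] by blast+
  show "twist_map f (twist_map g (shift_by i (twist (\<lambda>_. 0)))) =
      twist_map h (shift_by i (twist (\<lambda>_. 0)))" for i
    using twist_cong[of "\<lambda>k. f k + g k" h] fgh
    by (simp add: twist_map_shift_by twist_map_eta[OF g] twist_map_eta[OF h] twist_map_twist[OF f])
qed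

lemma twist_map_0: "twist_map (\<lambda>_. 0) x = x"
  by (simp add: twist_map_def)

text \<open>The inverse is the code with negated parameters.\<close>

lemma twist_map_automorphism:
  assumes f: "finite {k. k \<ge> 1 \<and> f k \<noteq> 0}"
  shows "restrict (twist_map f) X \<in> carrier (Aut_shift X)"
proof -
  have f': "finite {k. k \<ge> 1 \<and> - f k \<noteq> 0}"
    using f by simp
  have inv: "twist_map f (twist_map (\<lambda>k. - f k) x) = x" "twist_map (\<lambda>k. - f k) (twist_map f x) = x"
    if "x \<in> X" for x
    using that twist_map_add[of f "\<lambda>k. - f k" "\<lambda>_. 0"] twist_map_add[of "\<lambda>k. - f k" f "\<lambda>_. 0"] f f'
    by (simp_all add: twist_map_0)
  have mem: "twist_map f x \<in> X" "twist_map (\<lambda>k. - f k) x \<in> X" if "x \<in> X" for x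
    using that twist_map_in_X[OF f] twist_map_in_X[OF f'] by blast+
  have "homeomorphism X X (twist_map f) (twist_map (\<lambda>k. - f k))"
    using inv twist_map_in_X[OF f] twist_map_in_X[OF f'] finitary_twist_map[OF f]
      finitary_twist_map[OF f'] by (intro homeomorphismI finitary_continuous) auto
  then have h: "homeomorphism X X (restrict (twist_map f) X) (twist_map (\<lambda>k. - f k))"
    by (rule homeomorphism_cong) auto
  have "bij_betw (restrict (twist_map f) X) X X"
    using inv mem by (intro bij_betw_byWitness[where f' = "twist_map (\<lambda>k. - f k)"]) auto
  then have "restrict (twist_map f) X \<in> Bij X"
    by (simp add: Bij_def)
  with h show ?thesis
    using shift_in by (auto simp: Aut_shift_def shift_auts_def twist_map_shift_by)
qed

section \<open>Powers of the shift and rigidity of twisted points\<close>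

lemma shift_powersD:
  assumes "h \<in> shift_powers X"
  shows "\<exists>i. \<forall>x\<in>X. h x = shift_by i x"
proof -
  interpret G: group "Aut_shift X"
    by (rule group_Aut_shift)
  let ?s = "restrict left_shift X"
  have carr: "f \<in> carrier (Aut_shift X) \<Longrightarrow> x \<in> X \<Longrightarrow> f x \<in> X" for f x
    by (auto simp: Aut_shift_def shift_auts_def Bij_def bij_betw_def)
  have mult: "(f \<otimes>\<^bsub>Aut_shift X\<^esub> g) x = f (g x)"
    if "f \<in> carrier (Aut_shift X)" "g \<in> carrier (Aut_shift X)" "x \<in> X" for f g x
    using that by (auto simp: Aut_shift_def BijGroup_def shift_auts_def compose_def)
  \<comment> \<open>Membership in the group is carried through the induction because the formula for
    products needs it.\<close>
  have "h \<in> carrier (Aut_shift X) \<and> (\<exists>i. \<forall>x\<in>X. h x = shift_by i x)"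
    using assms unfolding shift_powers_def
  proof (induction rule: generate.induct)
    case one
    have "\<forall>x\<in>X. \<one>\<^bsub>Aut_shift X\<^esub> x = shift_by 0 x"
      by (simp add: Aut_shift_def BijGroup_def)
    then show ?case
      by blast
  next
    case (incl h)
    moreover have "\<forall>x\<in>X. ?s x = shift_by 1 x"
      by simp
    ultimately show ?case
      using restrict_shift_in by (metis singletonD)
  next
    case (inv h)
    let ?g = "inv\<^bsub>Aut_shift X\<^esub> ?s"
    have g: "?g \<in> carrier (Aut_shift X)"
      using restrict_shift_in by simp
    have "?g x = shift_by (- 1) x" if x: "x \<in> X" for x
    proof -
      have "left_shift (?g x) = (?s \<otimes>\<^bsub>Aut_shift X\<^esub> ?g) x"
        using mult[OF restrict_shift_in g x] carr[OF g x] by simp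
      also have "\<dots> = \<one>\<^bsub>Aut_shift X\<^esub> x"
        using restrict_shift_in by (simp add: G.r_inv)
      also have "\<dots> = x"
        using x by (simp add: Aut_shift_def BijGroup_def)
      finally have "shift_by (- 1) (left_shift (?g x)) = shift_by (- 1) x"
        by simp
      then show ?thesis
        by (simp flip: shift_by_add)
    qed
    with g inv show ?case
      by auto
  next
    case (eng h1 h2)
    then obtain i j where "\<forall>x\<in>X. h1 x = shift_by i x" "\<forall>x\<in>X. h2 x = shift_by j x"
      by blast
    then have "\<forall>x\<in>X. (h1 \<otimes>\<^bsub>Aut_shift X\<^esub> h2) x = shift_by (i + j) x"
      using eng mult shift_in by (auto simp: shift_by_add)
    then show ?case
      using eng by auto
  qed
  then show ?thesis
    by blast
qed

text \<open>For nonzero \<open>i\<close> take \<open>K\<close> with \<open>2 ^ K\<close> not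
  dividing \<open>i\<close>. Some one of \<open>twist g\<close> is congruent to \<open>i\<close>
  modulo \<open>2 ^ K\<close> and \<open>C K\<close>; shifted back by \<open>i\<close> it falls on a
  zero of \<open>twist f\<close>.\<close>

lemma twist_eq_shift_imp_0:
  assumes eq: "twist f = shift_by i (twist g)"
  shows "i = 0"
proof (rule ccontr)
  assume i: "i \<noteq> 0"
  let ?K = "Suc (nat \<bar>i\<bar>)"
  have "\<bar>i\<bar> < int ?K"
    by simp
  also have "int ?K < 2 ^ ?K"
    using of_nat_less_two_power by blast
  finally have "\<not> 2 ^ ?K dvd i"
    using i zdvd_imp_le[of "2 ^ ?K" "\<bar>i\<bar>"] by auto
  then obtain n where n: "2 ^ ?K dvd n - i" "C ?K dvd n - i" "twist g n"
    using twist_somewhere[of ?K i 0 i g] by (metis One_nat_def Suc_le_mono zero_le)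
  then have "\<not> twist f (n - i)"
    unfolding twist_iff by (metis One_nat_def Suc_le_mono zero_le)
  with n(3) show False
    by (simp add: eq shift_by_def)
qed

text \<open>The test position \<open>?n\<close> is a zero of eta that only the condition modulo
  \<open>(C k)\<^sup>2\<close> on level \<open>k\<close> can explain. So
  \<open>(C k)\<^sup>2\<close> divides \<open>f k * step k\<close>, while \<open>step k\<close>
  contains just one factor \<open>C k\<close>, up to a coprime cofactor.\<close>

lemma twist_eq_eta_imp_dvd:
  assumes eq: "twist f = twist (\<lambda>_. 0)" and k: "k \<ge> 1"
  shows "C k dvd f k"
proof -
  let ?n = "2 ^ (k - 1) * (C k)\<^sup>2"
  have C1: "\<not> C j dvd 1" if "j \<ge> 1" for j
    using c_gt_1[OF that] by simp
  have ndvd: "\<not> C j dvd ?n" if "j \<ge> 1" "j \<noteq> k" for j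
  proof
    have "coprime (C j) ?n"
      using coprime_two_power[OF that(1), of "k - 1"] coprime_c[of j k] that k
      by (simp add: coprime_commute)
    moreover assume "C j dvd ?n"
    ultimately have "C j dvd 1"
      by (rule coprime_common_divisor[OF _ dvd_refl])
    then show False
      using C1[OF that(1)] by simp
  qed
  have two: "\<not> 2 ^ k dvd ?n"
  proof
    assume "2 ^ k dvd ?n"
    then have "2 ^ (k - 1) * 2 dvd 2 ^ (k - 1) * (C k)\<^sup>2"
      using k by (metis One_nat_def Suc_diff_le diff_Suc_Suc diff_zero power_Suc2)
    then show False
      using odd_c[OF k] by simp
  qed
  have "\<not> twist (\<lambda>_. 0) ?n"
    using k unfolding twist_def by auto
  then have "\<not> twist f ?n"
    by (simp add: eq)
  then obtain j where j: "j \<ge> 1" "2 ^ j dvd ?n \<and> C j dvd ?n \<or>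
      2 ^ (j - 1) dvd ?n \<and> \<not> 2 ^ j dvd ?n \<and> (C j)\<^sup>2 dvd ?n + f j * step j"
    unfolding twist_iff by blast
  have "j = k"
  proof (rule ccontr)
    assume "j \<noteq> k"
    then have "C j dvd ?n + f j * step j"
      using j ndvd[of j] by (metis dvd_mult_left power2_eq_square)
    then show False
      using C_dvd_step[OF j(1) order_refl] ndvd[OF j(1) \<open>j \<noteq> k\<close>] by (simp add: dvd_add_left_iff)
  qed
  then have "(C k)\<^sup>2 dvd ?n + f k * step k"
    using j(2) two by blast
  have prod: "(\<Prod>j\<in>{1..k}. C j) = C k * (\<Prod>j\<in>{1..k} - {k}. C j)"
    using k by (intro prod.remove) auto
  have "(C k)\<^sup>2 dvd f k * step k"
    using \<open>(C k)\<^sup>2 dvd ?n + f k * step k\<close>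
    by (simp add: dvd_add_right_iff)
  also have "f k * step k = C k * (f k * (2 ^ k * (\<Prod>j\<in>{1..k} - {k}. C j)))"
    unfolding step_def prod by (simp only: ac_simps)
  finally have "C k dvd f k * (2 ^ k * (\<Prod>j\<in>{1..k} - {k}. C j))"
    using c_gt_1[OF k] by (simp add: power2_eq_square)
  moreover have "coprime (C k) (2 ^ k * (\<Prod>j\<in>{1..k} - {k}. C j))"
  proof -
    have "coprime (C k) (\<Prod>j\<in>{1..k} - {k}. C j)"
      by (rule prod_coprime_right) (use coprime_c[OF k] in fastforce)
    moreover have "coprime (C k) (2 ^ k)"
      using coprime_two_power[OF k] coprime_commute by blast
    ultimately show ?thesis
      using coprime_mult_right_iff by blast
  qed
  ultimately show ?thesis
    by (simp add: coprime_dvd_mult_left_iff)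
qed

section \<open>Embedding the direct sum into the quotient\<close>

definition coset_of :: "(nat \<Rightarrow> int) \<Rightarrow> ((int \<Rightarrow> bool) \<Rightarrow> (int \<Rightarrow> bool)) set"
  where "coset_of f = shift_powers X #>\<^bsub>Aut_shift X\<^esub> restrict (twist_map f) X"

text \<open>Elements are finitely supported choices of residues, \<open>undefined\<close> at index
  0; hence supports are taken over \<open>k \<ge> 1\<close>.\<close>

abbreviation S :: "(nat \<Rightarrow> int) monoid"
  where "S \<equiv> sum_group {1..} (\<lambda>k. integer_mod_group (c k))"

lemma finite_support: "f \<in> carrier S \<Longrightarrow> finite {k. k \<ge> 1 \<and> f k \<noteq> 0}"
  by (simp add: carrier_sum_group)

lemma twist_map_hom: "(\<lambda>f. restrict (twist_map f) X) \<in> hom S (Aut_shift X)"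
proof (rule homI)
  fix f g assume fg: "f \<in> carrier S" "g \<in> carrier S"
  have "f \<otimes>\<^bsub>S\<^esub> g \<in> carrier S"
    using fg by (intro monoid.m_closed[OF group.is_monoid[OF sum_group]]) simp_all
  note supp = finite_support[OF fg(1)] finite_support[OF fg(2)] finite_support[OF this]
  have "twist_map f (twist_map g x) = twist_map (f \<otimes>\<^bsub>S\<^esub> g) x" if "x \<in> X" for x
    \<comment> \<open>The product reduces \<open>f k + g k\<close> modulo \<open>c k\<close>, which
      \<open>twist_map_add\<close> allows.\<close>
    by (rule twist_map_add[OF supp _ that]) (simp add: dvd_minus_mod)
  then show "restrict (twist_map (f \<otimes>\<^bsub>S\<^esub> g)) X =
      restrict (twist_map f) X \<otimes>\<^bsub>Aut_shift X\<^esub> restrict (twist_map g) X"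
    using twist_map_automorphism[OF supp(1)] twist_map_automorphism[OF supp(2)] twist_map_in_X[OF supp(2)]
    by (auto simp: Aut_shift_def BijGroup_def shift_auts_def compose_def image_subset_iff fun_eq_iff
        simp del: mult_sum_group)
qed (use twist_map_automorphism finite_support in blast)

lemma group_hom_coset: "group_hom S (Aut_shift X Mod shift_powers X) coset_of"
proof -
  interpret N: normal "shift_powers X" "Aut_shift X"
    by (rule normal_shift_powers)
  have "coset_of \<in> hom S (Aut_shift X Mod shift_powers X)"
    using hom_compose[OF twist_map_hom N.r_coset_hom_Mod] by (simp add: coset_of_def[abs_def] comp_def)
  then show ?thesis
    by (simp add: group_hom_def group_hom_axioms_def N.factorgroup_is_group)
qed

text \<open>A code in the trivial coset is a power of the shift. Evaluating it at eta forces
  exponent 0, then \<open>C k\<close> divides each \<open>f k\<close>, and the reduced residues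
  vanish.\<close>

lemma inj_coset: "inj_on coset_of (carrier S)"
proof -
  interpret N: normal "shift_powers X" "Aut_shift X"
    by (rule normal_shift_powers)
  interpret H: group_hom S "Aut_shift X Mod shift_powers X" coset_of
    by (rule group_hom_coset)
  have trivial: "f = \<one>\<^bsub>S\<^esub>" if f: "f \<in> carrier S" and one: "coset_of f = shift_powers X" for f
  proof -
    have fin: "finite {k. k \<ge> 1 \<and> f k \<noteq> 0}"
      using f by (rule finite_support)
    have "restrict (twist_map f) X \<in> shift_powers X"
      using N.rcos_self[OF twist_map_automorphism[OF fin] N.subgroup_axioms] one
      by (simp add: coset_of_def)
    then obtain i where "\<forall>x\<in>X. restrict (twist_map f) X x = shift_by i x"
      using shift_powersD by blast
    then have eq: "twist f = shift_by i (twist (\<lambda>_. 0))"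
      using twist_in_X[of "\<lambda>_. 0"] twist_map_eta[OF fin] by simp
    then have "twist f = twist (\<lambda>_. 0)"
      using twist_eq_shift_imp_0[OF eq] by simp
    then have "C k dvd f k" if "k \<ge> 1" for k
      using that by (rule twist_eq_eta_imp_dvd)
    moreover have "0 \<le> f k" "f k < C k" if "k \<ge> 1" for k
    proof -
      have "f k \<in> carrier (integer_mod_group (c k))"
        using f that by (auto simp: carrier_sum_group PiE_iff)
      then show "0 \<le> f k" "f k < C k"
        using c_gt_1[OF that] by (auto simp: carrier_integer_mod_group split: if_splits)
    qed
    ultimately have "f k = 0" if "k \<ge> 1" for k
      using that by (metis mod_0_imp_dvd mod_pos_pos_trivial dvd_imp_mod_0)
    moreover have "f \<in> extensional {1..}"
      using f by (simp add: carrier_sum_group PiE_iff)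
    ultimately show ?thesis
      by (auto simp: extensional_def restrict_def fun_eq_iff)
  qed
  have "kernel S (Aut_shift X Mod shift_powers X) coset_of = {\<one>\<^bsub>S\<^esub>}"
  proof
    show "kernel S (Aut_shift X Mod shift_powers X) coset_of \<subseteq> {\<one>\<^bsub>S\<^esub>}"
      using trivial unfolding kernel_def one_FactGroup by blast
    show "{\<one>\<^bsub>S\<^esub>} \<subseteq> kernel S (Aut_shift X Mod shift_powers X) coset_of"
      using H.hom_one H.G.one_closed unfolding kernel_def by blast
  qed
  then show ?thesis
    unfolding H.inj_iff_trivial_ker .
qed

end

theorem corollary3p25:
  fixes c :: "nat \<Rightarrow> nat"
  assumes "\<And>k. k \<ge> 1 \<Longrightarrow> odd (c k) \<and> c k > 1"
    and "pairwise (\<lambda>i j. coprime (c i) (c j)) {1..}"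
  shows "let X = free_subshift (B1_infty c); Q = Aut_shift X Mod shift_powers X in
    \<exists>H. subgroup H Q \<and>
      sum_group {1..} (\<lambda>k. integer_mod_group (c k)) \<cong> Q\<lparr>carrier := H\<rparr>"
proof -
  interpret odd_coprime_seq c
    using assms by unfold_locales (auto simp: pairwise_def)
  interpret H: group_hom S "Aut_shift X Mod shift_powers X" coset_of
    by (rule group_hom_coset)
  let ?H = "coset_of ` carrier S"
  have "coset_of \<in> iso S ((Aut_shift X Mod shift_powers X)\<lparr>carrier := ?H\<rparr>)"
    using inj_coset H.hom_mult by (auto simp: iso_def hom_def bij_betw_def)
  then show ?thesis
    using H.img_is_subgroup unfolding Let_def is_iso_def by blast
qed

end
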